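(* Let $d_{\rm H}\ge 1$ and let $\mathfrak{m}=\{\{\rho_i\},\{\mathcal{M}_j\},\{E_k\}\}$ be a physical representation on a $d_{\rm H}$-dimensional Hilbert space, with finitely many states $\rho_i$ and finitely many maps $\mathcal{M}_j$. Let $C_j$ denote the Choi matrix of $\mathcal{M}_j$. If the model $[\mathfrak{m}]$ is nontrivial and unique, then at least one of the states $\rho_i$ or one of the Choi matrices $C_j$ is not full rank, i.e. $$\prod_i \det(\rho_i)\times\prod_j\det(C_j)=0 .$$
   Context: Fix a Hilbert space of finite dimension $d_{\rm H}$, identified with $\mathbb{C}^{d_{\rm H}}$ through an orthonormal basis $\{|a\rangle\}$; $\mathbb{1}$ is the identity matrix. A representation $\mathfrak{m}=\{\{\rho_i\},\{\mathcal{M}_j\},\{E_k\}\}$ consists of an indexed family of $d_{\rm H}\times d_{\rm H}$ complex matrices $\rho_i$ (states), an indexed family of linear maps $\mathcal{M}_j$ on the space of $d_{\rm H}\times d_{\rm H}$ complex matrices, and an indexed family of $d_{\rm H}\times d_{\rm H}$ matrices $E_k$ (measurement operators). It is physical if every $\rho_i$ is Hermitian, positive semidefinite with $\mathrm{Tr}(\rho_i)=1$, every $\mathcal{M}_j$ is completely positive and trace-preserving, and every $E_k$ is Hermitian with $0\le E_k\le \mathbb{1}$. Its probability distribution is $p_{\mathfrak{m}}(i,j_1,\dots,j_N,k)=\mathrm{Tr}[E_k\,\mathcal{M}_{j_N}\cdots\mathcal{M}_{j_1}(\rho_i)]$ for all $i,k$, all $N\ge 0$ and all $j_1,\dots,j_N$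 ($N=0$ meaning no map is applied). Two representations with the same index sets and on the same Hilbert space dimension are distribution-equivalent if their distributions coincide. Let $\langle\mathfrak{m}\rangle$ be the set of all physical representations $\mathfrak{m}'$ (same index sets, same dimension $d_{\rm H}$) with $p_{\mathfrak{m}'}=p_{\mathfrak{m}}$. For an invertible linear map $\mathcal{T}$ on the matrix space, put $\mathcal{T}(\mathfrak{m})=\{\{\mathcal{T}^{-1}(\rho_i)\},\{\mathcal{T}^{-1}\mathcal{M}_j\mathcal{T}\},\{\mathcal{T}^*(E_k)\}\}$, where $\mathcal{T}^*$ is the dual map defined by $\mathrm{Tr}[\mathcal{T}^*(A)B]=\mathrm{Tr}[A\,\mathcal{T}(B)]$ for all matrices $A,B$. Let $\mathbb{U}$ be the set of unitary maps $\mathcal{U}(X)=uXu^\dagger$ with $u$ a unitary $d_{\rm H}\times d_{\rm H}$ matrix, let $\mathcal{W}(X)=X^{\rm T}$ be the transpose map in the fixed basis, and let $\mathbb{S}=\mathbb{U}\cup\mathcal{W}\mathbb{U}$, where $\mathcal{W}\mathbb{U}=\{\mathcal{W}\circ\mathcal{U}:\mathcal{U}\in\mathbb{U}\}$ (unitary and anti-unitary transformations). The model of $\mathfrak{m}$ is $[\mathfrak{m}]=\{\mathcal{S}(\mathfrak{m}) : \mathcal{S}\in\mathbb{S}\}$; it is called physical if $\mathfrak{m}$ is physical, and a physical model is unique if $[\mathfrak{m}]=\langle\mathfrak{m}\rangle$. The model is trivial if $\rho_i=d_{\rm H}^{-1}\mathbb{1}$ for all $i$, $\mathcal{M}_j(\mathbb{1})=\mathbb{1}$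 for all $j$, and $E_k=\mathrm{Tr}(E_k)\,d_{\rm H}^{-1}\mathbb{1}$ for all $k$; otherwise it is nontrivial. The Choi matrix of a linear map $\mathcal{M}$ is $C=\sum_{a,b}|a\rangle\langle b|\otimes\mathcal{M}(|a\rangle\langle b|)$. *)

theory Defs
  imports "HOL-Analysis.Analysis"
begin

text \<open>
  The Hilbert space is \<^typ>\<open>complex^'n\<close> with its standard basis, so its dimension is
  \<open>CARD('n)\<close>, which is at least 1 because types are nonempty.
\<close>

type_synonym 'n cmat = "complex^'n^'n"

definition adj :: "'n::finite cmat \<Rightarrow> 'n cmat" where
  "adj A = (\<chi> i j. cnj (A $ j $ i))"

definition hermitian :: "'n::finite cmat \<Rightarrow> bool" where
  "hermitian A \<longleftrightarrow> adj A = A"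

definition unitary :: "'n::finite cmat \<Rightarrow> bool" where
  "unitary u \<longleftrightarrow> adj u ** u = mat 1 \<and> u ** adj u = mat 1"

text \<open>The sesquilinear form \<open>\<langle>v|A|w\<rangle>\<close>.\<close>

definition sesq :: "complex^'n \<Rightarrow> 'n::finite cmat \<Rightarrow> complex^'n \<Rightarrow> complex" where
  "sesq v A w = (\<Sum>i\<in>UNIV. \<Sum>j\<in>UNIV. cnj (v $ i) * A $ i $ j * w $ j)"

definition psd :: "'n::finite cmat \<Rightarrow> bool" where
  "psd A \<longleftrightarrow> hermitian A \<and> (\<forall>v. Re (sesq v A v) \<ge> 0)"

definition munit :: "'n::finite \<Rightarrow> 'n \<Rightarrow> 'n cmat" where
  "munit a b = (\<chi> i j. if i = a \<and> j = b then 1 else 0)"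

definition kron :: "'m::finite cmat \<Rightarrow> 'n::finite cmat \<Rightarrow> ('m \<times> 'n) cmat" where
  "kron A B = (\<chi> p q. A $ fst p $ fst q * B $ snd p $ snd q)"

definition cscale :: "complex \<Rightarrow> 'n::finite cmat \<Rightarrow> 'n cmat" where
  "cscale c A = (\<chi> i j. c * A $ i $ j)"

lemma vector_space_cscale: "vector_space cscale"
  by unfold_locales (simp_all add: cscale_def vec_eq_iff algebra_simps)

definition clinear :: "('n::finite cmat \<Rightarrow> 'n cmat) \<Rightarrow> bool" where
  "clinear M \<longleftrightarrow> Vector_Spaces.linear cscale cscale M"

text \<open>
  A \<open>k \<times> k\<close> block matrix with \<open>n \<times> n\<close> blocks \<open>X a b\<close> (\<open>a, b < k\<close>), that is, an operator on
  the tensor product of \<open>k\<close>-dimensional space with \<^typ>\<open>complex^'n\<close>; the family \<open>v\<close> of blocks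
  is a vector of that product space. Complete positivity asks that \<open>id \<otimes> M\<close>, the blockwise
  application of \<open>M\<close>, preserves positivity for every ancilla dimension \<open>k\<close>.
\<close>

definition block_psd :: "nat \<Rightarrow> (nat \<Rightarrow> nat \<Rightarrow> 'n::finite cmat) \<Rightarrow> bool" where
  "block_psd k X \<longleftrightarrow>
     (\<forall>a<k. \<forall>b<k. X b a = adj (X a b)) \<and>
     (\<forall>v :: nat \<Rightarrow> complex^'n. Re (\<Sum>a<k. \<Sum>b<k. sesq (v a) (X a b) (v b)) \<ge> 0)"

definition completely_positive :: "('n::finite cmat \<Rightarrow> 'n cmat) \<Rightarrow> bool" where
  "completely_positive M \<longleftrightarrow>
     (\<forall>k X. block_psd k X \<longrightarrow> block_psd k (\<lambda>a b. M (X a b)))"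

definition trace_preserving :: "('n::finite cmat \<Rightarrow> 'n cmat) \<Rightarrow> bool" where
  "trace_preserving M \<longleftrightarrow> (\<forall>X. trace (M X) = trace X)"

definition choi :: "('n::finite cmat \<Rightarrow> 'n cmat) \<Rightarrow> ('n \<times> 'n) cmat" where
  "choi M = (\<Sum>a\<in>UNIV. \<Sum>b\<in>UNIV. kron (munit a b) (M (munit a b)))"

definition dual_map :: "('n::finite cmat \<Rightarrow> 'n cmat) \<Rightarrow> 'n cmat \<Rightarrow> 'n cmat" where
  "dual_map T = (THE T'. \<forall>A B. trace (T' A ** B) = trace (A ** T B))"

lemma trace_mult_munit: "trace (X ** munit a b) = X $ b $ a"
proof -
  have "(X ** munit a b) $ i $ i = (if i = b then X $ b $ a else 0)" for i
    by (simp add: matrix_matrix_mult_def munit_def if_distrib cong: if_cong)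
  then show ?thesis by (simp add: trace_def)
qed

lemma matrix_expand: "B = (\<Sum>a\<in>UNIV. \<Sum>b\<in>UNIV. cscale (B $ a $ b) (munit a b))"
proof -
  have "(\<Sum>a\<in>UNIV. \<Sum>b\<in>UNIV. B $ a $ b * (if i = a \<and> j = b then 1 else 0))
      = (\<Sum>a\<in>UNIV. if i = a then B $ i $ j else 0)" for i j
    by (rule sum.cong) (simp_all add: if_distrib cong: if_cong)
  then show ?thesis
    by (simp add: vec_eq_iff cscale_def munit_def)
qed

text \<open>The defining property determines the dual of a linear map uniquely.\<close>

lemma dual_map_trace:
  assumes "clinear T"
  shows "trace (dual_map T A ** B) = trace (A ** T B)"
proof -
  interpret Vector_Spaces.linear cscale cscale T
    using assms by (simp add: clinear_def)
  have tr_scale: "trace (A ** cscale c X) = c * trace (A ** X)" for A X :: "'a cmat" and c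
    by (simp add: trace_def matrix_matrix_mult_def cscale_def sum_distrib_left mult.left_commute)
  have tr_sum: "trace (A ** sum f S) = (\<Sum>s\<in>S. trace (A ** f s))"
    if "finite S" for A :: "'a cmat" and f :: "'a \<Rightarrow> 'a cmat" and S
    using that
    by (induction S) (simp_all add: matrix_add_ldistrib trace_add, simp add: trace_def)
  have tr_expand: "trace (X ** L B) = (\<Sum>a\<in>UNIV. \<Sum>b\<in>UNIV. B $ a $ b * trace (X ** L (munit a b)))"
    if L: "Vector_Spaces.linear cscale cscale L" for X B and L :: "'a cmat \<Rightarrow> 'a cmat"
  proof -
    interpret L: Vector_Spaces.linear cscale cscale L by (fact L)
    have "L B = (\<Sum>a\<in>UNIV. \<Sum>b\<in>UNIV. cscale (B $ a $ b) (L (munit a b)))"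
      by (subst matrix_expand[of B]) (simp add: L.sum L.scale)
    then show ?thesis by (simp add: tr_sum tr_scale)
  qed
  have lin_id: "Vector_Spaces.linear cscale cscale (\<lambda>X :: 'a cmat. X)"
    using vector_space.linear_ident[OF vector_space_cscale] .
  let ?D = "\<lambda>A. \<chi> i j. trace (A ** T (munit j i))"
  have D: "trace (?D A ** B) = trace (A ** T B)" for A B
    using tr_expand[OF lin_id, of "?D A" B]
      tr_expand[OF linear_axioms, of A B]
    by (simp add: trace_mult_munit)
  have "dual_map T = ?D"
    unfolding dual_map_def
  proof (rule the_equality)
    show "\<forall>A B. trace (?D A ** B) = trace (A ** T B)" using D by blast
    fix T' assume T': "\<forall>A B. trace (T' A ** B) = trace (A ** T B)"
    show "T' = ?D"
    proof
      fix A
      have "T' A $ i $ j = trace (A ** T (munit j i))" for i j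
        using T' trace_mult_munit[of "T' A" j i] by simp
      then show "T' A = ?D A" by (simp add: vec_eq_iff)
    qed
  qed
  then show ?thesis using D by simp
qed

text \<open>
  The three index sets are part of a representation and may be empty. The families are
  extensional (undefined off their index sets), so that equality of representations is
  equality of the indexed families.
\<close>

record ('i, 'j, 'k, 'n::finite) representation =
  state_ix :: "'i set"
  map_ix :: "'j set"
  meas_ix :: "'k set"
  rho :: "'i \<Rightarrow> 'n cmat"
  chan :: "'j \<Rightarrow> 'n cmat \<Rightarrow> 'n cmat"
  eff :: "'k \<Rightarrow> 'n cmat"

definition is_representation :: "('i, 'j, 'k, 'n::finite) representation \<Rightarrow> bool" where
  "is_representation m \<longleftrightarrow>
     rho m \<in> extensional (state_ix m) \<and>
     chan m \<in> extensional (map_ix m) \<and>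
     eff m \<in> extensional (meas_ix m) \<and>
     (\<forall>j\<in>map_ix m. clinear (chan m j))"

definition physical :: "('i, 'j, 'k, 'n::finite) representation \<Rightarrow> bool" where
  "physical m \<longleftrightarrow>
     is_representation m \<and>
     (\<forall>i\<in>state_ix m. psd (rho m i) \<and> trace (rho m i) = 1) \<and>
     (\<forall>j\<in>map_ix m. completely_positive (chan m j) \<and> trace_preserving (chan m j)) \<and>
     (\<forall>k\<in>meas_ix m. psd (eff m k) \<and> psd (mat 1 - eff m k))"

text \<open>The head of the list \<open>js\<close> is the map applied first.\<close>

definition prob_dist ::
    "('i, 'j, 'k, 'n::finite) representation \<Rightarrow> 'i \<Rightarrow> 'j list \<Rightarrow> 'k \<Rightarrow> complex" where
  "prob_dist m i js k = trace (eff m k ** fold (chan m) js (rho m i))"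

definition dist_equiv ::
    "('i, 'j, 'k, 'n::finite) representation \<Rightarrow> ('i, 'j, 'k, 'n) representation \<Rightarrow> bool" where
  "dist_equiv m m' \<longleftrightarrow>
     state_ix m' = state_ix m \<and> map_ix m' = map_ix m \<and> meas_ix m' = meas_ix m \<and>
     (\<forall>i\<in>state_ix m. \<forall>js\<in>lists (map_ix m). \<forall>k\<in>meas_ix m.
        prob_dist m' i js k = prob_dist m i js k)"

definition equiv_physical ::
    "('i, 'j, 'k, 'n::finite) representation \<Rightarrow> ('i, 'j, 'k, 'n) representation set" where
  "equiv_physical m = {m'. physical m' \<and> dist_equiv m m'}"

definition transform ::
    "('n::finite cmat \<Rightarrow> 'n cmat) \<Rightarrow> ('i, 'j, 'k, 'n) representation
      \<Rightarrow> ('i, 'j, 'k, 'n) representation" where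
  "transform T m =
     \<lparr> state_ix = state_ix m, map_ix = map_ix m, meas_ix = meas_ix m,
       rho = (\<lambda>i\<in>state_ix m. inv T (rho m i)),
       chan = (\<lambda>j\<in>map_ix m. inv T \<circ> chan m j \<circ> T),
       eff = (\<lambda>k\<in>meas_ix m. dual_map T (eff m k)) \<rparr>"

definition unitary_maps :: "('n::finite cmat \<Rightarrow> 'n cmat) set" where
  "unitary_maps = {(\<lambda>X. u ** X ** adj u) | u. unitary u}"

definition symmetries :: "('n::finite cmat \<Rightarrow> 'n cmat) set" where
  "symmetries = unitary_maps \<union> {transpose \<circ> U | U. U \<in> unitary_maps}"

definition model ::
    "('i, 'j, 'k, 'n::finite) representation \<Rightarrow> ('i, 'j, 'k, 'n) representation set" where
  "model m = {transform S m | S. S \<in> symmetries}"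

definition unique_model :: "('i, 'j, 'k, 'n::finite) representation \<Rightarrow> bool" where
  "unique_model m \<longleftrightarrow> model m = equiv_physical m"

text \<open>Here \<open>mat c\<close> is \<open>c\<close> times the identity matrix.\<close>

definition trivial_model :: "('i, 'j, 'k, 'n::finite) representation \<Rightarrow> bool" where
  "trivial_model m \<longleftrightarrow>
     (\<forall>i\<in>state_ix m. rho m i = mat (1 / of_nat CARD('n))) \<and>
     (\<forall>j\<in>map_ix m. chan m j (mat 1) = mat 1) \<and>
     (\<forall>k\<in>meas_ix m. eff m k = mat (trace (eff m k) / of_nat CARD('n)))"

end

theory Submission
  imports Defs
begin

text \<open>
  If all states and all Choi matrices were nonsingular, they would be bounded below by a common
  \<open>\<delta> \<cdot> 1\<close>, \<open>\<delta> > 0\<close>. Conjugating the whole representation by a depolarizing channel \<open>T\<close>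
  close to the identity then keeps it physical: \<open>T\<close> is self-dual and preserves effects, while
  applying the non-positive map \<open>T\<^sup>-\<^sup>1\<close> costs the states and Choi matrices at most \<open>\<delta>\<close>. By
  uniqueness \<open>T\<close> acts on the representation like some unitary or anti-unitary \<open>S\<close>. But \<open>S\<close>
  preserves the Hilbert-Schmidt norm of traceless parts, whereas \<open>T\<close> rescales it by a factor
  different from 1, so all traceless parts vanish and the model is trivial.
\<close>

section \<open>Positive semidefinite matrices\<close>

text \<open>A singular matrix has no left inverse, so its rows do not span the space. This turns a
  vanishing determinant into the rank half of the final statement.\<close>

lemma det_eq_0_imp_rank_less:
  fixes A :: "'a::field^'n^'n"
  assumes "det A = 0"
  shows "rank A < CARD('n)"
proof -
  have "\<not> (\<exists>B. B ** A = mat 1)"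
    using assms by (metis invertible_det_nz invertible_left_inverse)
  then have "vec.span (rows A) \<noteq> UNIV"
    by (simp add: matrix_left_invertible_span_rows_gen)
  then have "vec.dim (rows A) \<noteq> CARD('n)"
    by (metis vec.dim_eq_full vec_dim_card vec.dim_UNIV vec.dimension_def)
  moreover have "vec.dim (rows A) \<le> CARD('n)"
    by (rule dim_subset_UNIV_cart_gen)
  ultimately show ?thesis by (simp add: row_rank_def_gen)
qed

section \<open>Adjoints and the sesquilinear form\<close>

lemma adj_nth [simp]: "adj A $ i $ j = cnj (A $ j $ i)"
  by (simp add: adj_def)

lemma adj_add: "adj (A + B) = adj A + adj B"
  by (simp add: vec_eq_iff)

lemma adj_diff: "adj (A - B) = adj A - adj B"
  by (simp add: vec_eq_iff)

lemma adj_scaleR: "adj (r *\<^sub>R A) = r *\<^sub>R adj A"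
  by (simp add: vec_eq_iff scaleR_conv_of_real[where 'a=complex])

lemma adj_mat_of_real: "adj (mat (of_real r)) = mat (of_real r)"
  by (simp add: vec_eq_iff mat_def)

lemma hermitian_nth: "hermitian A \<Longrightarrow> cnj (A $ i $ j) = A $ j $ i"
  by (metis adj_nth hermitian_def)

lemma sesq_mult_vec: "sesq v A w = (\<Sum>i\<in>UNIV. cnj (v $ i) * (A *v w) $ i)"
  by (simp add: sesq_def matrix_vector_mult_def sum_distrib_left mult.assoc)

lemma sesq_mult_vec_left: "sesq v A w = (\<Sum>i\<in>UNIV. cnj ((adj A *v v) $ i) * w $ i)"
  unfolding sesq_def matrix_vector_mult_def
  by (subst sum.swap) (simp add: sum_distrib_left mult_ac)

text \<open>\<open>K\<close> moves to the vectors as \<open>adj K\<close>, so a Kraus term tests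
  \<open>X\<close> on transformed vectors.\<close>

lemma sesq_conjugate: "sesq v (K ** X ** adj K) w = sesq (adj K *v v) X (adj K *v w)"
proof -
  have "sesq v (K ** X ** adj K) w = sesq v K ((X ** adj K) *v w)"
    by (simp add: sesq_mult_vec matrix_vector_mul_assoc matrix_mul_assoc)
  also have "\<dots> = (\<Sum>i\<in>UNIV. cnj ((adj K *v v) $ i) * ((X ** adj K) *v w) $ i)"
    by (rule sesq_mult_vec_left)
  also have "\<dots> = sesq (adj K *v v) X (adj K *v w)"
    by (simp add: sesq_mult_vec matrix_vector_mul_assoc)
  finally show ?thesis .
qed

lemma sesq_add: "sesq v (A + B) w = sesq v A w + sesq v B w"
  by (simp add: sesq_def algebra_simps sum.distrib)

lemma sesq_diff: "sesq v (A - B) w = sesq v A w - sesq v B w"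
  by (simp add: sesq_def algebra_simps sum_subtractf)

lemma sesq_scaleR: "sesq v (r *\<^sub>R A) w = of_real r * sesq v A w"
  by (simp add: sesq_def sum_distrib_left scaleR_conv_of_real[where 'a=complex] mult_ac)

lemma sesq_sum: "sesq v (sum F S) w = (\<Sum>s\<in>S. sesq v (F s) w)"
  by (induction S rule: infinite_finite_induct) (simp_all add: sesq_add, simp_all add: sesq_def)

lemma sesq_mat: "sesq v (mat c) v = c * of_real ((norm v)\<^sup>2)"
proof -
  have "sesq v (mat c) v = (\<Sum>i\<in>UNIV. c * (cnj (v $ i) * v $ i))"
    by (simp add: sesq_def mat_def if_distrib if_distribR mult_ac cong: if_cong)
  also have "\<dots> = c * of_real (\<Sum>i\<in>UNIV. (norm (v $ i))\<^sup>2)"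
    by (simp add: sum_distrib_left complex_norm_square mult.commute del: of_real_power)
  also have "(\<Sum>i\<in>UNIV. (norm (v $ i))\<^sup>2) = (norm v)\<^sup>2"
    by (simp add: norm_vec_def L2_set_def sum_nonneg)
  finally show ?thesis .
qed

lemma sesq_hermitian:
  assumes "hermitian A"
  shows "sesq w A v = cnj (sesq v A w)"
proof -
  have "cnj (sesq v A w) = (\<Sum>j\<in>UNIV. \<Sum>i\<in>UNIV. v $ i * A $ j $ i * cnj (w $ j))"
    using assms unfolding sesq_def
    by (subst sum.swap) (simp add: hermitian_nth)
  then show ?thesis by (simp add: sesq_def mult_ac)
qed

lemma psd_mat: "r \<ge> 0 \<Longrightarrow> psd (mat (of_real r))"
  by (simp add: psd_def hermitian_def adj_mat_of_real sesq_mat del: of_real_power)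

lemma psd_add: "psd A \<Longrightarrow> psd B \<Longrightarrow> psd (A + B)"
  by (simp add: psd_def hermitian_def adj_add sesq_add)

lemma psd_scaleR: "psd A \<Longrightarrow> r \<ge> 0 \<Longrightarrow> psd (r *\<^sub>R A)"
  by (simp add: psd_def hermitian_def adj_scaleR sesq_scaleR)

lemma psd_diff_mat_mono:
  assumes "psd (A - mat (of_real \<delta>))" "\<epsilon> \<le> \<delta>"
  shows "psd (A - mat (of_real \<epsilon>))"
proof -
  have "A - mat (of_real \<epsilon>) = (A - mat (of_real \<delta>)) + mat (of_real (\<delta> - \<epsilon>))"
    by (simp add: vec_eq_iff mat_def)
  then show ?thesis using psd_add[OF assms(1) psd_mat[of "\<delta> - \<epsilon>"]] assms(2) by (metis diff_ge_0_iff_ge)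
qed

text \<open>Perturbing \<open>v\<close> along \<open>w = A *v v\<close> by a real \<open>t\<close>
  gives \<open>2 * t * b + t^2 * c\<close> with \<open>b\<close> the squared norm of
  \<open>w\<close>. Nonnegativity for both signs of \<open>t\<close> kills the linear coefficient
  \<open>b\<close>.\<close>

lemma psd_sesq_eq_0:
  assumes A: "psd A" and 0: "Re (sesq v A v) = 0"
  shows "A *v v = 0"
proof -
  define w where "w = A *v v"
  define b where "b = (norm w)\<^sup>2"
  define c where "c = Re (sesq w A w)"
  have wv: "sesq w A v = of_real b"
    using sesq_mat[of w 1] unfolding b_def sesq_mult_vec[of w A] w_def[symmetric]
    by (simp add: sesq_mult_vec)
  then have vw: "sesq v A w = of_real b"
    using A sesq_hermitian[of A v w] by (simp add: psd_def)
  have "sesq (v + t *\<^sub>R w) A (v + t *\<^sub>R w)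
      = sesq v A v + of_real t * (sesq v A w + sesq w A v) + of_real (t\<^sup>2) * sesq w A w" for t
    by (simp add: sesq_def scaleR_conv_of_real[where 'a=complex] algebra_simps sum.distrib
        sum_distrib_left power2_eq_square)
  then have "Re (sesq (v + t *\<^sub>R w) A (v + t *\<^sub>R w)) = 2 * t * b + t\<^sup>2 * c" for t
    using 0 vw wv by (simp add: c_def)
  then have *: "2 * t * b + t\<^sup>2 * c \<ge> 0" for t
    using A unfolding psd_def by metis
  have c: "c \<ge> 0" using A by (simp add: c_def psd_def)
  have "b = 0"
  proof (rule ccontr)
    assume "b \<noteq> 0"
    \<comment> \<open>At \<open>- t\<close> the quadratic equals \<open>- (t^2 * (c + 2))\<close>,
      which is negative; the summand 1 keeps the denominator positive when
      \<open>c = 0\<close>.\<close>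
    define t where "t = b / (c + 1)"
    have "t \<noteq> 0" using \<open>b \<noteq> 0\<close> c by (simp add: t_def)
    have "b = t * (c + 1)" using c by (simp add: t_def)
    then have "2 * (- t) * b + (- t)\<^sup>2 * c = - (t\<^sup>2 * (c + 2))"
      by (simp add: algebra_simps power2_eq_square)
    moreover have "t\<^sup>2 * (c + 2) > 0"
      using c \<open>t \<noteq> 0\<close> by (intro mult_pos_pos) auto
    ultimately show False using *[of "- t"] by linarith
  qed
  then show ?thesis by (simp add: b_def w_def)
qed

text \<open>A trivial kernel makes the form strictly positive off 0. Its minimum on the compact unit
  sphere, the smallest eigenvalue, serves as \<open>\<delta>\<close>, and homogeneity extends the
  bound to all vectors.\<close>

lemma psd_det_nonzero_lower_bound:
  fixes A :: "'n::finite cmat"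
  assumes A: "psd A" and d: "det A \<noteq> 0"
  obtains \<delta> where "\<delta> > 0" "psd (A - mat (of_real \<delta>))"
proof -
  let ?f = "\<lambda>v. Re (sesq v A v)"
  have pos: "?f v > 0" if "v \<noteq> 0" for v
  proof -
    have "\<forall>x. A *v x = 0 \<longrightarrow> x = 0"
      using d invertible_det_nz[of A] matrix_left_invertible_ker[of A]
      by (simp add: invertible_left_inverse)
    then have "?f v \<noteq> 0" using psd_sesq_eq_0[OF A] that by blast
    moreover have "?f v \<ge> 0" using A by (simp add: psd_def)
    ultimately show ?thesis by simp
  qed
  have "compact (sphere (0 :: complex^'n) 1)" by simp
  \<comment> \<open>Any standard basis vector shows that the sphere is nonempty, as attaining the
    minimum requires.\<close>
  moreover have "axis undefined 1 \<in> sphere (0 :: complex^'n) 1" by simp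
  then have "sphere (0 :: complex^'n) 1 \<noteq> {}" by blast
  moreover have "continuous_on (sphere 0 1) ?f"
    unfolding sesq_def by (intro continuous_intros)
  ultimately obtain v0 where v0: "v0 \<in> sphere 0 1" "\<And>v. v \<in> sphere 0 1 \<Longrightarrow> ?f v0 \<le> ?f v"
    using continuous_attains_inf[of "sphere (0 :: complex^'n) 1" ?f] by blast
  have bound: "?f v \<ge> ?f v0 * (norm v)\<^sup>2" for v
  proof (cases "v = 0")
    case False
    define u where "u = (1 / norm v) *\<^sub>R v"
    have v: "v = norm v *\<^sub>R u" using False by (simp add: u_def)
    have "sesq v A v = of_real ((norm v)\<^sup>2) * sesq u A u"
      by (subst (1 2) v) (simp add: sesq_def scaleR_conv_of_real[where 'a=complex]
          sum_distrib_left power2_eq_square mult_ac)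
    then have "?f v = (norm v)\<^sup>2 * ?f u" by (simp del: of_real_power)
    moreover have "?f u \<ge> ?f v0" by (rule v0) (use False in \<open>simp add: u_def\<close>)
    ultimately show ?thesis by (simp add: mult.commute mult_right_mono)
  qed (simp add: sesq_def)
  show thesis
  proof
    show "?f v0 > 0" using v0(1) by (intro pos) auto
    show "psd (A - mat (of_real (?f v0)))"
      using A bound unfolding psd_def
      by (simp add: sesq_diff sesq_mat hermitian_def adj_diff adj_mat_of_real del: of_real_power)
  qed
qed

text \<open>Cholesky elimination: each step splits off the rank-one part of one index and leaves
  the Schur complement.\<close>

lemma psd_rank_one_decomposition:
  fixes A :: "'a \<Rightarrow> 'a \<Rightarrow> complex"
  assumes "finite I"
    and "\<And>p q. p \<in> I \<Longrightarrow> q \<in> I \<Longrightarrow> A q p = cnj (A p q)"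
    and "\<And>v. Re (\<Sum>p\<in>I. \<Sum>q\<in>I. cnj (v p) * A p q * v q) \<ge> 0"
  shows "\<exists>g. \<forall>p\<in>I. \<forall>q\<in>I. A p q = (\<Sum>r\<in>I. g r p * cnj (g r q))"
  using assms
proof (induction I arbitrary: A rule: finite_induct)
  case (insert x I)
  have herm: "A q p = cnj (A p q)" if "p \<in> insert x I" "q \<in> insert x I" for p q
    using insert.prems(1) that by blast
  \<comment> \<open>The form is split at the pivot index: \<open>z\<close> is the coordinate at
    \<open>x\<close>, and \<open>u\<close> holds the others.\<close>
  have nonneg: "Re (cnj z * A x x * z + cnj z * (\<Sum>q\<in>I. A x q * u q)
      + (\<Sum>p\<in>I. cnj (u p) * A p x) * z + (\<Sum>p\<in>I. \<Sum>q\<in>I. cnj (u p) * A p q * u q)) \<ge> 0"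
    for z u
  proof -
    let ?v = "u(x := z)"
    have v: "?v p = u p" if "p \<in> I" for p using that insert.hyps by auto
    have "(\<Sum>p\<in>insert x I. \<Sum>q\<in>insert x I. cnj (?v p) * A p q * ?v q)
      = cnj z * A x x * z + (\<Sum>q\<in>I. cnj z * A x q * u q)
        + (\<Sum>p\<in>I. cnj (u p) * A p x * z + (\<Sum>q\<in>I. cnj (u p) * A p q * u q))"
      using insert.hyps by (simp add: v del: fun_upd_apply cong: sum.cong) simp
    also have "\<dots> = cnj z * A x x * z + cnj z * (\<Sum>q\<in>I. A x q * u q)
      + (\<Sum>p\<in>I. cnj (u p) * A p x) * z + (\<Sum>p\<in>I. \<Sum>q\<in>I. cnj (u p) * A p q * u q)"
      by (simp add: sum.distrib sum_distrib_left sum_distrib_right mult.assoc)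
    finally show ?thesis using insert.prems(2)[of ?v] by metis
  qed
  define a where "a = Re (A x x)"
  have "cnj (A x x) = A x x" using herm[of x x] by simp
  then have a: "A x x = of_real a" by (simp add: a_def complex_eq_iff)
  have "a \<ge> 0" using nonneg[of 1 "\<lambda>_. 0"] by (simp add: a)
  \<comment> \<open>With a zero pivot the form depends on \<open>z\<close> only through a
    real-linear term, which would be unbounded below unless the pivot column vanishes.\<close>
  have zero: "A y x = 0" if "a = 0" "y \<in> I" for y
  proof (rule ccontr)
    assume nz: "A y x \<noteq> 0"
    define c where "c = Re (A y y)"
    \<comment> \<open>This value brings the real part of the form down to -1.\<close>
    define t where "t = - (c + 1) / (2 * (norm (A y x))\<^sup>2)"
    let ?u = "\<lambda>p. if p = y then 1 else 0 :: complex"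
    have pick: "(\<Sum>q\<in>I. F q * ?u q) = F y" "(\<Sum>p\<in>I. cnj (?u p) * F p) = F y" for F
      using that insert.hyps by (simp_all add: if_distrib if_distribR cong: if_cong)
    have "(\<Sum>p\<in>I. \<Sum>q\<in>I. cnj (?u p) * A p q * ?u q) = A y y"
      unfolding pick(1) by (rule pick(2))
    moreover define z where "z = of_real t * A x y"
    ultimately have "Re (cnj z * A x y + A y x * z + A y y) \<ge> 0"
      using nonneg[of z ?u] unfolding pick by (simp add: \<open>a = 0\<close> a)
    moreover have "A x y = cnj (A y x)" using herm[of y x] that by simp
    then have "cnj z * A x y + A y x * z = of_real (2 * t * (norm (A y x))\<^sup>2)"
      by (simp add: z_def complex_norm_square algebra_simps del: of_real_power)
    ultimately have "2 * t * (norm (A y x))\<^sup>2 + c \<ge> 0"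
      by (simp add: c_def del: of_real_power of_real_mult)
    moreover have "2 * t * (norm (A y x))\<^sup>2 = - (c + 1)" using nz by (simp add: t_def)
    ultimately show False by simp
  qed
  \<comment> \<open>The Schur complement of the pivot. Division by 0 yields 0, so
    \<open>B = A\<close> when \<open>a = 0\<close>.\<close>
  define B where "B = (\<lambda>p q. A p q - A p x * A x q / of_real a)"
  have "\<exists>g. \<forall>p\<in>I. \<forall>q\<in>I. B p q = (\<Sum>r\<in>I. g r p * cnj (g r q))"
  proof (rule insert.IH)
    show "B q p = cnj (B p q)" if "p \<in> I" "q \<in> I" for p q
    proof -
      have "A q p = cnj (A p q)" "A q x = cnj (A x q)" "A x p = cnj (A p x)"
        using herm that by blast+
      then show ?thesis by (simp add: B_def mult.commute)
    qed
    fix u :: "'a \<Rightarrow> complex"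
    define s where "s = (\<Sum>q\<in>I. A x q * u q)"
    have s': "(\<Sum>p\<in>I. cnj (u p) * A p x) = cnj s"
      unfolding s_def cnj_sum
    proof (rule sum.cong)
      show "cnj (u p) * A p x = cnj (A x p * u p)" if "p \<in> I" for p
        using herm[of x p] that by simp
    qed simp
    \<comment> \<open>Completing the square: for \<open>a > 0\<close> this coordinate minimizes the
      form for fixed \<open>u\<close>, and the minimum is the form of \<open>B\<close>. For
      \<open>a = 0\<close> it is 0.\<close>
    define z where "z = - s / of_real a"
    have "cnj z * A x x * z + cnj z * s + cnj s * z = - (cnj s * s / of_real a)"
      by (cases "a = 0") (simp_all add: z_def a)
    moreover have "cnj s * s / of_real a
        = (\<Sum>p\<in>I. \<Sum>q\<in>I. cnj (u p) * (A p x * A x q / of_real a) * u q)"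
      unfolding s'[symmetric] unfolding s_def sum_product sum_divide_distrib by (simp add: mult_ac)
    ultimately show "Re (\<Sum>p\<in>I. \<Sum>q\<in>I. cnj (u p) * B p q * u q) \<ge> 0"
      using nonneg[of z u, unfolded s' s_def[symmetric]]
      by (simp add: B_def left_diff_distrib right_diff_distrib sum_subtractf)
  qed
  then obtain g where g: "\<And>p q. p \<in> I \<Longrightarrow> q \<in> I \<Longrightarrow> B p q = (\<Sum>r\<in>I. g r p * cnj (g r q))"
    by blast
  \<comment> \<open>The new vector is the pivot column divided by \<open>sqrt a\<close>; the vectors
    obtained for \<open>B\<close> are extended by 0 at \<open>x\<close>.\<close>
  define h where "h = (\<lambda>r p. if r = x then A p x / of_real (sqrt a) else if p = x then 0 else g r p)"
  have sq: "of_real (sqrt a) * of_real (sqrt a) = (of_real a :: complex)"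
    using \<open>a \<ge> 0\<close> by (simp flip: of_real_mult)
  have hx: "h x p * cnj (h x q) = A p x * A x q / of_real a" if "q \<in> insert x I" for p q
    using herm[of q x] that by (simp add: h_def sq)
  have h: "(\<Sum>r\<in>I. h r p * cnj (h r q)) = (if p = x \<or> q = x then 0 else \<Sum>r\<in>I. g r p * cnj (g r q))" for p q
  proof -
    have "h r p = (if p = x then 0 else g r p)" if "r \<in> I" for r p
      using that insert.hyps by (auto simp: h_def)
    then show ?thesis by (auto intro!: sum.cong)
  qed
  have "A p q = (\<Sum>r\<in>insert x I. h r p * cnj (h r q))" if "p \<in> insert x I" "q \<in> insert x I" for p q
  proof -
    have "A p q = A p x * A x q / of_real a" if "p = x \<or> q = x"
      using that \<open>p \<in> insert x I\<close> \<open>q \<in> insert x I\<close> herm[of p x] herm[of q x] zero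
      by (cases "a = 0") (auto simp: a)
    moreover have "A p q = A p x * A x q / of_real a + (\<Sum>r\<in>I. g r p * cnj (g r q))"
      if "p \<noteq> x" "q \<noteq> x"
      using g[of p q] that \<open>p \<in> insert x I\<close> \<open>q \<in> insert x I\<close> by (simp add: B_def diff_eq_eq add.commute)
    ultimately show ?thesis using insert.hyps that by (simp add: hx h)
  qed
  then show ?case by blast
qed simp

section \<open>Complete positivity and Choi matrices\<close>

text \<open>The case of a one-dimensional ancilla; constant families of vectors already test the
  single block.\<close>

lemma completely_positive_psd:
  assumes "completely_positive M" "psd A"
  shows "psd (M A)"
proof -
  have block: "block_psd 1 (\<lambda>_ _. B) \<longleftrightarrow> psd B" for B :: "'a cmat"
    unfolding block_psd_def psd_def hermitian_def
    by (auto dest: spec[of _ "\<lambda>_. v" for v])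
  show ?thesis
    using assms(1)[unfolded completely_positive_def, rule_format, of 1 "\<lambda>_ _. A"] assms(2)
    by (simp only: block)
qed

lemma munit_nth: "munit a b $ i $ j = (if i = a \<and> j = b then 1 else 0)"
  by (simp add: munit_def)

lemma choi_nth: "choi M $ p $ q = M (munit (fst p) (fst q)) $ snd p $ snd q"
proof -
  have "(\<Sum>b\<in>UNIV. munit a b $ fst p $ fst q * M (munit a b) $ snd p $ snd q)
      = (if fst p = a then M (munit a (fst q)) $ snd p $ snd q else 0)" for a
    by (simp add: munit_nth if_distrib if_distribR cong: if_cong)
  then show ?thesis by (simp add: choi_def kron_def)
qed

lemma sum_UNIV_prod: "(\<Sum>p\<in>UNIV. f p) = (\<Sum>a\<in>UNIV. \<Sum>b\<in>UNIV. f (a, b))"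
  by (simp add: sum.cartesian_product case_prod_unfold flip: UNIV_Times_UNIV)

text \<open>A vector on the product index is cut into blocks by its first index, which relates
  positivity of the Choi matrix to positivity of the block matrix with blocks
  \<open>M (munit a b)\<close>.\<close>

lemma sesq_choi:
  "sesq v (choi M) w
    = (\<Sum>a\<in>UNIV. \<Sum>b\<in>UNIV. sesq (\<chi> i. v $ (a, i)) (M (munit a b)) (\<chi> i. w $ (b, i)))"
proof -
  have "sesq v (choi M) w = (\<Sum>a\<in>UNIV. \<Sum>i\<in>UNIV. \<Sum>b\<in>UNIV. \<Sum>j\<in>UNIV.
      cnj (v $ (a, i)) * M (munit a b) $ i $ j * w $ (b, j))"
    by (simp add: sesq_def sum_UNIV_prod choi_nth)
  also have "\<dots> = (\<Sum>a\<in>UNIV. \<Sum>b\<in>UNIV. \<Sum>i\<in>UNIV. \<Sum>j\<in>UNIV.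
      cnj (v $ (a, i)) * M (munit a b) $ i $ j * w $ (b, j))"
    by (rule sum.cong[OF refl]) (rule sum.swap)
  finally show ?thesis by (simp add: sesq_def)
qed

lemma sesq_munit: "sesq v (munit a b) w = cnj (v $ a) * w $ b"
proof -
  have "(\<Sum>j\<in>UNIV. cnj (v $ i) * munit a b $ i $ j * w $ j)
      = (if i = a then cnj (v $ i) * w $ b else 0)" for i
    by (simp add: munit_nth if_distrib if_distribR cong: if_cong)
  then show ?thesis by (simp add: sesq_def)
qed

text \<open>The Choi matrix is the image of the unnormalized maximally entangled projector, whose
  blocks are the matrix units.\<close>

lemma completely_positive_psd_choi:
  fixes M :: "'n::finite cmat \<Rightarrow> 'n cmat"
  assumes cp: "completely_positive M"
  shows "psd (choi M)"
proof -
  let ?k = "CARD('n)"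
  \<comment> \<open>Blocks are numbered by naturals in \<open>block_psd\<close>, so the basis has to
    be enumerated.\<close>
  obtain h :: "nat \<Rightarrow> 'n" where h: "bij_betw h {..<?k} UNIV"
    using ex_bij_betw_nat_finite[of "UNIV :: 'n set"] by (auto simp: atLeast0LessThan)
  have "block_psd ?k (\<lambda>a b. munit (h a) (h b))"
    unfolding block_psd_def
  proof (intro conjI allI impI)
    show "munit (h b) (h a) = adj (munit (h a) (h b))" for a b
      by (simp add: vec_eq_iff munit_nth conj_commute)
    show "Re (\<Sum>a<?k. \<Sum>b<?k. sesq (v a) (munit (h a) (h b)) (v b)) \<ge> 0" for v
    proof -
      have "(\<Sum>a<?k. \<Sum>b<?k. sesq (v a) (munit (h a) (h b)) (v b))
          = cnj (\<Sum>a<?k. v a $ h a) * (\<Sum>a<?k. v a $ h a)"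
        by (simp add: sesq_munit sum_product)
      moreover have "Re (cnj z * z) \<ge> 0" for z by simp
      ultimately show ?thesis by metis
    qed
  qed
  then have M: "block_psd ?k (\<lambda>a b. M (munit (h a) (h b)))"
    using cp by (simp add: completely_positive_def)
  have surj: "\<exists>x<?k. h x = a" for a
    using h by (metis UNIV_I bij_betw_iff_bijections lessThan_iff)
  have "adj (M (munit a b)) = M (munit b a)" for a b
  proof -
    obtain x y where "x < ?k" "h x = a" "y < ?k" "h y = b" using surj by metis
    then show ?thesis using M unfolding block_psd_def by metis
  qed
  then have "cnj (M (munit a b) $ i $ j) = M (munit b a) $ j $ i" for a b i j
    by (metis adj_nth)
  then have "adj (choi M) = choi M"
    by (simp add: vec_eq_iff choi_nth)
  moreover have "Re (sesq v (choi M) v) \<ge> 0" for v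
  proof -
    define w where "w = (\<lambda>a. \<chi> i. v $ (a, i))"
    define G where "G = (\<lambda>a b. sesq (w a) (M (munit a b)) (w b))"
    have "(\<Sum>a<?k. \<Sum>b<?k. G (h a) (h b)) = (\<Sum>a<?k. \<Sum>b\<in>UNIV. G (h a) b)"
      using sum.reindex_bij_betw[OF h, of "G (h a)" for a] by simp
    also have "\<dots> = sesq v (choi M) v"
      using sum.reindex_bij_betw[OF h, of "\<lambda>a. \<Sum>b\<in>UNIV. G a b"]
      by (simp add: sesq_choi G_def w_def)
    finally have "sesq v (choi M) v
        = (\<Sum>a<?k. \<Sum>b<?k. sesq (w (h a)) (M (munit (h a) (h b))) (w (h b)))"
      by (simp add: G_def)
    then show ?thesis
      using conjunct2[OF M[unfolded block_psd_def], rule_format, of "\<lambda>a. w (h a)"] by simp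
  qed
  ultimately show ?thesis by (simp add: psd_def hermitian_def)
qed

section \<open>From positive Choi matrices back to complete positivity\<close>

lemma clinear_iff:
  "clinear M \<longleftrightarrow> (\<forall>A B. M (A + B) = M A + M B) \<and> (\<forall>c A. M (cscale c A) = cscale c (M A))"
  by (simp add: clinear_def Vector_Spaces.linear_iff vector_space_cscale)

lemma clinear_expand:
  assumes "clinear M"
  shows "M A = (\<Sum>a\<in>UNIV. \<Sum>b\<in>UNIV. cscale (A $ a $ b) (M (munit a b)))"
proof -
  interpret Vector_Spaces.linear cscale cscale M
    using assms by (simp add: clinear_def)
  show ?thesis by (subst matrix_expand[of A]) (simp add: sum scale)
qed

text \<open>For each \<open>r\<close> the block form of the image at \<open>v\<close> is the block
  form of \<open>X\<close> at the vectors \<open>adj (K r) *v v a\<close>, hence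
  nonnegative.\<close>

lemma completely_positive_Kraus:
  fixes M :: "'n::finite cmat \<Rightarrow> 'n cmat"
  assumes K: "\<And>X. M X = (\<Sum>r\<in>R. K r ** X ** adj (K r))"
  shows "completely_positive M"
  unfolding completely_positive_def
proof (intro allI impI)
  fix k and X :: "nat \<Rightarrow> nat \<Rightarrow> 'n cmat"
  assume X: "block_psd k X"
  have adj_sum: "adj (\<Sum>r\<in>R. F r) = (\<Sum>r\<in>R. adj (F r))" for F :: "_ \<Rightarrow> 'n cmat"
    by (simp add: vec_eq_iff)
  have adj_mult: "adj (A ** B) = adj B ** adj A" for A B :: "'n cmat"
    by (simp add: vec_eq_iff matrix_matrix_mult_def mult.commute)
  have adj_adj: "adj (adj A) = A" for A :: "'n cmat"
    by (simp add: vec_eq_iff)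
  show "block_psd k (\<lambda>a b. M (X a b))"
    unfolding block_psd_def
  proof (intro conjI allI impI)
    show "M (X b a) = adj (M (X a b))" if "a < k" "b < k" for a b
    proof -
      have "X b a = adj (X a b)" using X that unfolding block_psd_def by blast
      then show ?thesis by (simp add: K adj_sum adj_mult adj_adj matrix_mul_assoc)
    qed
    fix v :: "nat \<Rightarrow> complex^'n"
    have "(\<Sum>a<k. \<Sum>b<k. sesq (v a) (M (X a b)) (v b))
        = (\<Sum>a<k. \<Sum>b<k. \<Sum>r\<in>R. sesq (adj (K r) *v v a) (X a b) (adj (K r) *v v b))"
      by (simp add: K sesq_sum sesq_conjugate)
    also have "\<dots> = (\<Sum>a<k. \<Sum>r\<in>R. \<Sum>b<k. sesq (adj (K r) *v v a) (X a b) (adj (K r) *v v b))"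
      by (rule sum.cong[OF refl]) (rule sum.swap)
    also have "\<dots> = (\<Sum>r\<in>R. \<Sum>a<k. \<Sum>b<k. sesq (adj (K r) *v v a) (X a b) (adj (K r) *v v b))"
      by (rule sum.swap)
    moreover have "Re (\<Sum>a<k. \<Sum>b<k. sesq (adj (K r) *v v a) (X a b) (adj (K r) *v v b)) \<ge> 0" for r
      using X unfolding block_psd_def by (elim conjE allE[of _ "\<lambda>a. adj (K r) *v v a"])
    ultimately show "Re (\<Sum>a<k. \<Sum>b<k. sesq (v a) (M (X a b)) (v b)) \<ge> 0"
      by (simp add: sum_nonneg)
  qed
qed

text \<open>Rank-one terms of the Choi matrix are Kraus operators in disguise, so the decomposition
  of a positive matrix yields a Kraus form of \<open>M\<close>.\<close>

lemma psd_choi_completely_positive: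
  fixes M :: "'n::finite cmat \<Rightarrow> 'n cmat"
  assumes lin: "clinear M" and C: "psd (choi M)"
  shows "completely_positive M"
proof -
  have "\<exists>g :: 'n \<times> 'n \<Rightarrow> 'n \<times> 'n \<Rightarrow> complex.
      \<forall>p\<in>UNIV. \<forall>q\<in>UNIV. choi M $ p $ q = (\<Sum>r\<in>UNIV. g r p * cnj (g r q))"
  proof (rule psd_rank_one_decomposition)
    show "choi M $ q $ p = cnj (choi M $ p $ q)" for p q
      using C by (simp add: psd_def hermitian_nth)
    show "Re (\<Sum>p\<in>UNIV. \<Sum>q\<in>UNIV. cnj (v p) * choi M $ p $ q * v q) \<ge> 0" for v
      using C unfolding psd_def sesq_def by (auto dest: spec[of _ "\<chi> i. v i"])
  qed simp
  then obtain g :: "'n \<times> 'n \<Rightarrow> 'n \<times> 'n \<Rightarrow> complex"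
    where g: "\<And>p q. choi M $ p $ q = (\<Sum>r\<in>UNIV. g r p * cnj (g r q))"
    by blast
  have entry: "M (munit a b) $ i $ j = (\<Sum>r\<in>UNIV. g r (a, i) * cnj (g r (b, j)))" for a b i j
    using g[of "(a, i)" "(b, j)"] by (simp add: choi_nth)
  \<comment> \<open>Each vector is reshaped into a matrix: the first component of the pair is the
    input (column) index, the second the output (row) index.\<close>
  define K where "K = (\<lambda>r. (\<chi> i a. g r (a, i)) :: 'n cmat)"
  have "M X $ i $ j = (\<Sum>r\<in>UNIV. K r ** X ** adj (K r)) $ i $ j" for X i j
  proof -
    have "M X $ i $ j = (\<Sum>a\<in>UNIV. \<Sum>b\<in>UNIV. \<Sum>r\<in>UNIV. g r (a, i) * X $ a $ b * cnj (g r (b, j)))"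
      by (subst clinear_expand[OF lin]) (simp add: cscale_def entry sum_distrib_left mult_ac)
    also have "\<dots> = (\<Sum>b\<in>UNIV. \<Sum>a\<in>UNIV. \<Sum>r\<in>UNIV. g r (a, i) * X $ a $ b * cnj (g r (b, j)))"
      by (rule sum.swap)
    also have "\<dots> = (\<Sum>b\<in>UNIV. \<Sum>r\<in>UNIV. \<Sum>a\<in>UNIV. g r (a, i) * X $ a $ b * cnj (g r (b, j)))"
      by (rule sum.cong[OF refl]) (rule sum.swap)
    also have "\<dots> = (\<Sum>r\<in>UNIV. \<Sum>b\<in>UNIV. \<Sum>a\<in>UNIV. g r (a, i) * X $ a $ b * cnj (g r (b, j)))"
      by (rule sum.swap)
    finally show ?thesis
      by (simp add: K_def matrix_matrix_mult_def sum_distrib_right)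
  qed
  then show ?thesis
    by (intro completely_positive_Kraus[where K = K and R = UNIV]) (simp add: vec_eq_iff)
qed

section \<open>Depolarizing maps\<close>

lemma mat_nth: "mat c $ i $ j = (if i = j then c else 0)"
  by (simp add: mat_def)

lemma matrix_add_rdistrib: "(A + B) ** C = A ** C + B ** C"
  by (simp add: vec_eq_iff matrix_matrix_mult_def distrib_right sum.distrib)

lemma matrix_diff_ldistrib: "C ** (A - B) = C ** A - C ** B" for A :: "'a::ring_1^'n^'m"
  by (simp add: vec_eq_iff matrix_matrix_mult_def right_diff_distrib sum_subtractf)

lemma matrix_diff_rdistrib: "(A - B) ** C = A ** C - B ** C" for A :: "'a::ring_1^'n^'m"
  by (simp add: vec_eq_iff matrix_matrix_mult_def left_diff_distrib sum_subtractf)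

text \<open>The depolarizing maps for all real \<open>r\<close>; those with \<open>r > 1\<close> need not be positive but serve as
  inverses of the channels with \<open>0 < r < 1\<close>.\<close>

definition depol :: "real \<Rightarrow> 'n::finite cmat \<Rightarrow> 'n cmat" where
  "depol r X = r *\<^sub>R X + mat (of_real ((1 - r) / CARD('n)) * trace X)"

lemma depol_nth:
  "depol r (X :: 'n::finite cmat) $ i $ j
    = of_real r * X $ i $ j + (if i = j then of_real ((1 - r) / CARD('n)) * trace X else 0)"
  by (simp add: depol_def mat_nth scaleR_conv_of_real[where 'a=complex])

lemma trace_cscale: "trace (cscale c A) = c * trace A"
  by (simp add: trace_def cscale_def sum_distrib_left)

lemma trace_adj: "trace (adj A) = cnj (trace A)"
  by (simp add: trace_def)

lemma trace_mat: "trace (mat c :: 'n::finite cmat) = of_nat CARD('n) * c"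
  by (simp add: trace_def mat_def)

lemma trace_mult_mat: "trace (A ** mat c) = c * trace A" for A :: "'n::finite cmat"
  by (simp add: trace_def matrix_matrix_mult_def mat_def if_distrib sum_distrib_left mult.commute[of c]
      cong: if_cong)

lemma trace_scaleR: "trace (r *\<^sub>R A) = of_real r * trace A" for A :: "'n::finite cmat"
  by (simp add: trace_def scaleR_conv_of_real[where 'a=complex] sum_distrib_left)

lemma trace_mult_scaleR: "trace (A ** (r *\<^sub>R B)) = of_real r * trace (A ** B)" for A :: "'n::finite cmat"
  by (simp add: trace_def matrix_matrix_mult_def scaleR_conv_of_real[where 'a=complex] sum_distrib_left
      mult_ac)

lemma trace_depol [simp]: "trace (depol r X) = trace X"
  by (simp add: depol_def trace_add trace_scaleR trace_mat field_simps)

lemma trace_mult_depol: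
  "trace (A ** depol r (B :: 'n::finite cmat))
    = of_real r * trace (A ** B) + of_real ((1 - r) / CARD('n)) * (trace A * trace B)"
  by (simp add: depol_def matrix_add_ldistrib trace_add trace_mult_scaleR trace_mult_mat)

text \<open>Self-duality: the expansion of \<open>trace (A ** depol r B)\<close> is symmetric in
  \<open>A\<close> and \<open>B\<close>.\<close>

lemma trace_depol_mult: "trace (depol r A ** B) = trace (A ** depol r B)"
  by (subst trace_mul_sym) (simp add: trace_mult_depol trace_mul_sym[of B] mult.commute)

text \<open>\<open>depol r\<close> fixes multiples of the identity and multiplies the traceless part
  by \<open>r\<close>, so the factors multiply.\<close>

lemma depol_depol: "depol r (depol s X) = depol (r * s) X"
  by (simp add: vec_eq_iff depol_nth) (simp add: field_simps)

lemma depol_1 [simp]: "depol 1 X = X"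
  by (simp add: vec_eq_iff depol_nth)

lemma depol_mat [simp]: "depol r (mat c) = mat c"
  by (simp add: vec_eq_iff depol_nth trace_mat mat_nth field_simps)

lemma depol_diff: "depol r (A - B) = depol r A - depol r B"
  by (simp add: vec_eq_iff depol_nth trace_sub algebra_simps diff_divide_distrib)

lemma clinear_depol: "clinear (depol r)"
  by (simp add: clinear_iff vec_eq_iff depol_nth cscale_def trace_add trace_cscale[unfolded cscale_def]
      algebra_simps add_divide_distrib diff_divide_distrib)

lemma clinear_comp: "clinear f \<Longrightarrow> clinear g \<Longrightarrow> clinear (f \<circ> g)"
  by (simp add: clinear_iff)

lemma inv_depol: "r \<noteq> 0 \<Longrightarrow> inv (depol r) = depol (1 / r)"
  by (rule inv_unique_comp) (simp_all add: fun_eq_iff depol_depol)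

lemma dual_map_depol: "dual_map (depol r) = depol r"
proof
  fix A :: "'a cmat"
  have "trace (dual_map (depol r) A ** munit a b) = trace (depol r A ** munit a b)" for a b :: 'a
    by (simp add: dual_map_trace[OF clinear_depol] trace_depol_mult)
  then show "dual_map (depol r) A = depol r A"
    by (simp add: trace_mult_munit vec_eq_iff)
qed

section \<open>Positivity under depolarizing maps and under conjugation by them\<close>

lemma psd_trace:
  assumes "psd A"
  shows "trace A = of_real (Re (trace A))" "Re (trace A) \<ge> 0"
proof -
  have "cnj (trace A) = trace A"
    using assms by (simp add: psd_def hermitian_def flip: trace_adj)
  then show "trace A = of_real (Re (trace A))" by (simp add: complex_eq_iff)
  have "sesq (axis i 1) A (axis i 1) = A $ i $ i" for i
  proof -
    have "(\<Sum>l\<in>UNIV. cnj (axis i 1 $ k) * A $ k $ l * axis i 1 $ l)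
        = (if k = i then A $ i $ i else 0)" for k
      by (cases "k = i") (simp_all add: axis_def if_distrib[of "\<lambda>x. _ * x"] cong: if_cong)
    then show ?thesis by (simp add: sesq_def)
  qed
  then have "Re (A $ i $ i) \<ge> 0" for i
    using assms unfolding psd_def by metis
  then show "Re (trace A) \<ge> 0" by (simp add: trace_def sum_nonneg)
qed

lemma psd_depol:
  assumes "psd A" "0 \<le> r" "r \<le> 1"
  shows "psd (depol r A)"
proof -
  let ?t = "Re (trace A)"
  have "depol r A = r *\<^sub>R A + mat (of_real ((1 - r) / CARD('a) * ?t))"
    unfolding depol_def by (subst psd_trace(1)[OF assms(1)]) simp
  moreover have "(1 - r) / CARD('a) * ?t \<ge> 0"
    using psd_trace(2)[OF assms(1)] assms(3) by simp
  ultimately show ?thesis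
    using psd_add[OF psd_scaleR[OF assms(1,2)] psd_mat] by metis
qed

text \<open>At trace 1 the map yields \<open>(1 + \<delta>) A\<close> minus
  \<open>\<delta> / CARD('n)\<close> times the identity. The lower bound \<open>\<delta>\<close> on
  \<open>A\<close> pays for that loss.\<close>

lemma psd_depol_expanding:
  fixes A :: "'n::finite cmat"
  assumes A: "psd (A - mat (of_real \<delta>))" "trace A = 1" and "0 \<le> \<delta>"
  shows "psd (depol (1 + \<delta>) A)"
proof -
  have "psd A" using psd_diff_mat_mono[OF A(1) assms(3)] by simp
  have "\<delta> / CARD('n) \<le> \<delta>" using assms(3) by (simp add: divide_le_eq mult_le_cancel_left1)
  then have "psd (A - mat (of_real (\<delta> / CARD('n))))" using A(1) psd_diff_mat_mono by blast
  then have "psd (\<delta> *\<^sub>R A + (A - mat (of_real (\<delta> / CARD('n)))))"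
    using \<open>psd A\<close> assms(3) by (intro psd_add psd_scaleR)
  moreover have "\<delta> *\<^sub>R A + (A - mat (of_real (\<delta> / CARD('n)))) = depol (1 + \<delta>) A"
    using A(2) by (simp add: vec_eq_iff depol_nth mat_nth scaleR_conv_of_real[where 'a=complex] algebra_simps)
  ultimately show ?thesis by simp
qed

text \<open>The matrix is block diagonal with copies of \<open>P\<close>, so its form is a sum of
  forms of \<open>P\<close>.\<close>

lemma psd_kron_mat_1:
  assumes "psd P"
  shows "psd (kron (mat 1 :: 'm::finite cmat) (P :: 'n::finite cmat))"
proof -
  have "sesq v (kron (mat 1) P) v = (\<Sum>a\<in>UNIV. sesq (\<chi> i. v $ (a, i)) P (\<chi> i. v $ (a, i)))"
    for v :: "complex^('m \<times> 'n)"
  proof -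
    have "(\<Sum>b\<in>UNIV. \<Sum>j\<in>UNIV. cnj (v $ (a, i)) * (mat 1 $ a $ b * P $ i $ j) * v $ (b, j))
        = (\<Sum>j\<in>UNIV. cnj (v $ (a, i)) * P $ i $ j * v $ (a, j))" for a i
    proof -
      have "(\<Sum>b\<in>UNIV. \<Sum>j\<in>UNIV. cnj (v $ (a, i)) * (mat 1 $ a $ b * P $ i $ j) * v $ (b, j))
          = (\<Sum>b\<in>UNIV. if a = b then \<Sum>j\<in>UNIV. cnj (v $ (a, i)) * P $ i $ j * v $ (a, j) else 0)"
        by (rule sum.cong) (auto simp: mat_def)
      then show ?thesis by simp
    qed
    then show ?thesis by (simp add: sesq_def sum_UNIV_prod kron_def)
  qed
  moreover have "adj (kron (mat 1 :: 'm cmat) P) = kron (mat 1) P"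
    using assms by (simp add: vec_eq_iff kron_def mat_nth psd_def hermitian_nth)
  ultimately show ?thesis
    using assms by (simp add: psd_def hermitian_def sum_nonneg)
qed

text \<open>The factors \<open>r\<close> and \<open>1 / r\<close> cancel on \<open>M X\<close>. What
  remains measures how far \<open>M\<close> is from fixing the identity, weighted by
  \<open>trace X\<close>.\<close>

lemma depol_conjugate:
  fixes M :: "'n::finite cmat \<Rightarrow> 'n cmat"
  assumes lin: "clinear M" and tp: "trace_preserving M" and "r \<noteq> 0"
  shows "depol r (M (depol (1 / r) X))
    = M X + cscale (of_real ((r - 1) / CARD('n)) * trace X) (M (mat 1) - mat 1)"
proof -
  have "depol (1 / r) X = cscale (of_real (1 / r)) X
      + cscale (of_real ((1 - 1 / r) / CARD('n)) * trace X) (mat 1)"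
    by (simp add: vec_eq_iff depol_nth cscale_def mat_nth)
  then have "M (depol (1 / r) X) = cscale (of_real (1 / r)) (M X)
      + cscale (of_real ((1 - 1 / r) / CARD('n)) * trace X) (M (mat 1))"
    using lin by (simp add: clinear_iff)
  moreover have "trace (M (depol (1 / r) X)) = trace X"
    using tp by (simp add: trace_preserving_def)
  ultimately show ?thesis
    using \<open>r \<noteq> 0\<close> by (simp add: vec_eq_iff depol_nth cscale_def mat_nth) (simp add: field_simps)
qed

text \<open>Conjugation adds a positive block-diagonal term to the Choi matrix and subtracts
  \<open>\<delta> / CARD('n)\<close> times the identity; the subtraction is covered by the lower
  bound on \<open>choi M\<close>.\<close>

lemma completely_positive_depol_conjugate:
  fixes M :: "'n::finite cmat \<Rightarrow> 'n cmat"
  assumes lin: "clinear M" and cp: "completely_positive M" and tp: "trace_preserving M"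
    and C: "psd (choi M - mat (of_real \<delta>))" and "0 \<le> \<delta>"
  shows "completely_positive (depol (1 + \<delta>) \<circ> M \<circ> depol (1 / (1 + \<delta>)))"
proof (rule psd_choi_completely_positive)
  let ?M = "depol (1 + \<delta>) \<circ> M \<circ> depol (1 / (1 + \<delta>))"
  let ?\<eta> = "\<delta> / CARD('n)"
  show "clinear ?M" using lin by (intro clinear_comp clinear_depol)
  have "?\<eta> \<le> \<delta>" using assms(5) by (simp add: divide_le_eq mult_le_cancel_left1)
  then have 1: "psd (choi M - mat (of_real ?\<eta>))" using C psd_diff_mat_mono by blast
  have "psd (mat 1 :: 'n cmat)" using psd_mat[of 1] by simp
  then have "psd (?\<eta> *\<^sub>R kron (mat 1 :: 'n cmat) (M (mat 1)))"
    using assms(5) by (intro psd_scaleR psd_kron_mat_1) (auto intro: completely_positive_psd[OF cp])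
  with 1 have "psd ((choi M - mat (of_real ?\<eta>)) + ?\<eta> *\<^sub>R kron (mat 1) (M (mat 1)))"
    by (rule psd_add)
  \<comment> \<open>Only diagonal matrix units have nonzero trace, which is why the correction has
    the shape identity tensor matrix.\<close>
  moreover have tr: "trace (munit a b :: 'n cmat) = (if a = b then 1 else 0)" for a b
    using trace_mult_munit[of "mat 1 :: 'n cmat" a b] by (auto simp: mat_nth)
  have "(choi M - mat (of_real ?\<eta>)) + ?\<eta> *\<^sub>R kron (mat 1) (M (mat 1)) = choi ?M"
    using assms(5)
    by (auto simp: vec_eq_iff choi_nth depol_conjugate[OF lin tp] kron_def cscale_def tr mat_nth
        scaleR_conv_of_real[where 'a=complex] prod_eq_iff algebra_simps
        diff_divide_distrib)
  ultimately show "psd (choi ?M)" by simp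
qed

section \<open>Symmetries and the variance of a matrix\<close>

text \<open>For Hermitian \<open>X\<close> this is the squared Hilbert-Schmidt norm of the traceless
  part. Written through traces alone, it is visibly invariant under maps preserving
  \<open>trace X\<close> and \<open>trace (X ** X)\<close>.\<close>

definition hs_variance :: "'n::finite cmat \<Rightarrow> complex" where
  "hs_variance X = trace (X ** X) - (trace X)\<^sup>2 / of_nat CARD('n)"

lemma hs_variance_depol: "hs_variance (depol r X) = (of_real r)\<^sup>2 * hs_variance X"
proof -
  have "trace (depol r X ** depol r X) = trace (X ** depol (r * r) X)"
    by (simp add: trace_depol_mult depol_depol)
  then show ?thesis
    by (simp add: hs_variance_def trace_mult_depol) (simp add: field_simps power2_eq_square)
qed

text \<open>Subtracting the mean leaves a Hermitian \<open>Y\<close> for which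
  \<open>trace (Y ** Y)\<close> is both the variance of \<open>X\<close> and the sum of the squared
  moduli of the entries of \<open>Y\<close>.\<close>

lemma hs_variance_eq_0:
  fixes X :: "'n::finite cmat"
  assumes herm: "hermitian X" and 0: "hs_variance X = 0"
  shows "X = mat (trace X / of_nat CARD('n))"
proof -
  define c where "c = trace X / of_nat CARD('n)"
  define Y where "Y = X - mat c"
  have "cnj (trace X) = trace X"
    using herm by (simp add: hermitian_def flip: trace_adj)
  then have c: "cnj c = c" by (simp add: c_def)
  have Y: "Y $ j $ i = cnj (Y $ i $ j)" for i j
    using hermitian_nth[OF herm, of i j] c by (simp add: Y_def mat_def)
  have "trace (Y ** Y) = trace (X ** X) - 2 * c * trace X + c * (c * of_nat CARD('n))"
    unfolding Y_def matrix_diff_ldistrib matrix_diff_rdistrib trace_sub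
    by (simp add: trace_mult_mat trace_mat trace_mul_sym[of "mat c" X])
  also have "\<dots> = 0"
    using 0 by (simp add: hs_variance_def c_def power2_eq_square)
  finally have "trace (Y ** Y) = 0" .
  moreover have "trace (Y ** Y) = (\<Sum>i\<in>UNIV. \<Sum>j\<in>UNIV. of_real ((norm (Y $ i $ j))\<^sup>2))"
  proof -
    have "Y $ i $ j * Y $ j $ i = of_real ((norm (Y $ i $ j))\<^sup>2)" for i j
      unfolding Y[of j i] by (simp only: complex_norm_square)
    then show ?thesis by (simp add: trace_def matrix_matrix_mult_def)
  qed
  ultimately have "complex_of_real (\<Sum>i\<in>UNIV. \<Sum>j\<in>UNIV. (norm (Y $ i $ j))\<^sup>2) = 0"
    by (simp del: of_real_power)
  then have "(\<Sum>i\<in>UNIV. \<Sum>j\<in>UNIV. (norm (Y $ i $ j))\<^sup>2) = 0"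
    using of_real_eq_0_iff by blast
  then have "Y $ i $ j = 0" for i j
    by (simp add: sum_nonneg_eq_0_iff sum_nonneg)
  then show ?thesis by (simp add: vec_eq_iff Y_def c_def)
qed

section \<open>Unitary and anti-unitary maps preserve the trace form\<close>

lemma unitary_mapsD:
  assumes "U \<in> unitary_maps"
  shows "clinear U" "bij U" "trace (U A ** U B) = trace (A ** B)" "U (mat 1) = mat 1"
proof -
  obtain u where U: "U = (\<lambda>X. u ** X ** adj u)" and u: "adj u ** u = mat 1" "u ** adj u = mat 1"
    using assms by (auto simp: unitary_maps_def unitary_def)
  show "clinear U"
    unfolding clinear_iff U
    by (simp add: matrix_add_ldistrib matrix_add_rdistrib)
      (simp add: vec_eq_iff cscale_def matrix_matrix_mult_def sum_distrib_left sum_distrib_right mult_ac)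
  have cancel: "adj u ** (u ** X) = X" "u ** (adj u ** X) = X" for X :: "'a cmat"
    by (simp_all add: matrix_mul_assoc u)
  show "bij U"
  proof (rule o_bij)
    show "(\<lambda>X. adj u ** X ** u) \<circ> U = id" "U \<circ> (\<lambda>X. adj u ** X ** u) = id"
      by (simp_all add: fun_eq_iff U cancel u flip: matrix_mul_assoc)
  qed
  have "U A ** U B = u ** ((A ** B) ** adj u)"
    by (simp add: U cancel flip: matrix_mul_assoc)
  then have "trace (U A ** U B) = trace (((A ** B) ** adj u) ** u)"
    by (metis trace_mul_sym)
  then show "trace (U A ** U B) = trace (A ** B)"
    by (simp add: u flip: matrix_mul_assoc)
  show "U (mat 1) = mat 1" by (simp add: U u)
qed

text \<open>Transposition reverses products and the trace is cyclic, so composing with it keeps the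
  properties of unitary maps.\<close>

lemma symmetriesD:
  assumes "S \<in> symmetries"
  shows "clinear S" "bij S" "trace (S A ** S B) = trace (A ** B)" "S (mat 1) = mat 1"
proof -
  have tr: "clinear (transpose :: 'a cmat \<Rightarrow> 'a cmat)" "bij (transpose :: 'a cmat \<Rightarrow> 'a cmat)"
    by (simp add: clinear_iff vec_eq_iff transpose_def cscale_def, rule o_bij[of transpose])
      (simp_all add: fun_eq_iff)
  have tr_mult: "trace (transpose X ** transpose Y) = trace (X ** Y)" for X Y :: "'a cmat"
    by (subst trace_mul_sym, subst matrix_transpose_mul[symmetric])
      (simp add: trace_def transpose_def)
  show "clinear S" "bij S" "trace (S A ** S B) = trace (A ** B)" "S (mat 1) = mat 1"
    using assms
    by (auto simp: symmetries_def clinear_comp bij_comp tr_mult tr unitary_mapsD)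
qed

text \<open>Preserving the bilinear trace form makes \<open>inv S\<close> the adjoint of
  \<open>S\<close>; pairing with the identity shows that the trace is kept as well.\<close>

lemma inv_symmetry:
  assumes "S \<in> symmetries"
  shows "trace (inv S A ** B) = trace (A ** S B)" "hs_variance (inv S A) = hs_variance A"
proof -
  note S = symmetriesD[OF assms]
  have inv: "S (inv S X) = X" for X using S(2) by (simp add: bij_is_surj surj_f_inv_f)
  show adjoint: "trace (inv S X ** Y) = trace (X ** S Y)" for X Y
    using S(3)[of "inv S X" Y] by (simp add: inv)
  have "trace (inv S A) = trace A" using adjoint[of A "mat 1"] by (simp add: S)
  moreover have "trace (inv S A ** inv S A) = trace (A ** A)" by (simp add: adjoint inv)
  ultimately show "hs_variance (inv S A) = hs_variance A" by (simp add: hs_variance_def)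
qed

text \<open>Under a symmetry, effects therefore transform exactly like states.\<close>

lemma dual_map_symmetry:
  assumes "S \<in> symmetries"
  shows "dual_map S A = inv S A"
proof -
  have "trace (dual_map S A ** munit a b) = trace (inv S A ** munit a b)" for a b
    using assms by (simp add: dual_map_trace symmetriesD(1) inv_symmetry(1))
  then show ?thesis by (simp add: trace_mult_munit vec_eq_iff)
qed

section \<open>Transformed representations\<close>

lemma finite_uniform_bound:
  fixes f :: "'a \<Rightarrow> real"
  assumes "finite I" "\<And>i. i \<in> I \<Longrightarrow> f i > 0"
  obtains \<delta> where "\<delta> > 0" "\<And>i. i \<in> I \<Longrightarrow> \<delta> \<le> f i"
proof
  \<comment> \<open>The extra 1 keeps the minimum meaningful for an empty index set.\<close>
  show "Min (insert 1 (f ` I)) > 0" using assms by simp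
  show "Min (insert 1 (f ` I)) \<le> f i" if "i \<in> I" for i using assms that by simp
qed

lemma finite_psd_lower_bound:
  fixes A :: "'a \<Rightarrow> 'n::finite cmat"
  assumes "finite I" "\<And>i. i \<in> I \<Longrightarrow> psd (A i) \<and> det (A i) \<noteq> 0"
  obtains \<delta> where "\<delta> > 0" "\<And>i. i \<in> I \<Longrightarrow> psd (A i - mat (of_real \<delta>))"
proof -
  have "\<forall>i\<in>I. \<exists>\<delta>>0. psd (A i - mat (of_real \<delta>))"
    using assms(2) psd_det_nonzero_lower_bound by metis
  then obtain f where f: "\<And>i. i \<in> I \<Longrightarrow> f i > 0 \<and> psd (A i - mat (of_real (f i)))"
    by metis
  obtain \<delta> where "\<delta> > 0" "\<And>i. i \<in> I \<Longrightarrow> \<delta> \<le> f i"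
    using finite_uniform_bound[OF assms(1)] f by metis
  with f show thesis by (intro that[of \<delta>]) (blast intro: psd_diff_mat_mono)+
qed

text \<open>Adjacent \<open>T\<close> and \<open>inv T\<close> cancel along the sequence of maps,
  and the dual map on the effect cancels the last \<open>inv T\<close>.\<close>

lemma dist_equiv_transform:
  fixes m :: "('i, 'j, 'k, 'n::finite) representation"
  assumes "clinear T" "bij T"
  shows "dist_equiv m (transform T m)"
proof -
  have inv: "T (inv T X) = X" for X using assms(2) by (simp add: bij_is_surj surj_f_inv_f)
  \<comment> \<open>The start \<open>X\<close> stays general because each map in the list replaces
    it.\<close>
  have fold: "fold (chan (transform T m)) js (inv T X) = inv T (fold (chan m) js X)"
    if "js \<in> lists (map_ix m)" for js X
    using that
  proof (induction js arbitrary: X)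
    case (Cons j js)
    then have "chan (transform T m) j (inv T X) = inv T (chan m j X)"
      by (simp add: transform_def inv)
    with Cons show ?case by simp
  qed simp
  have "prob_dist (transform T m) i js k = prob_dist m i js k"
    if "i \<in> state_ix m" "js \<in> lists (map_ix m)" "k \<in> meas_ix m" for i js k
  proof -
    have "rho (transform T m) i = inv T (rho m i)" "eff (transform T m) k = dual_map T (eff m k)"
      using that by (simp_all add: transform_def)
    then show ?thesis
      by (simp add: prob_dist_def fold[OF that(2)] dual_map_trace[OF assms(1)] inv)
  qed
  then show ?thesis by (simp add: dist_equiv_def transform_def)
qed

text \<open>States meet the expanding map and channels are conjugated, both at a cost covered by
  \<open>\<delta>\<close>; effects meet only the contracting map, which preserves
  positivity.\<close>

lemma physical_transform_depol:
  fixes m :: "('i, 'j, 'k, 'n::finite) representation"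
  assumes m: "physical m" and "\<delta> > 0"
    and rho: "\<And>i. i \<in> state_ix m \<Longrightarrow> psd (rho m i - mat (of_real \<delta>))"
    and choi: "\<And>j. j \<in> map_ix m \<Longrightarrow> psd (choi (chan m j) - mat (of_real \<delta>))"
  shows "physical (transform (depol (1 / (1 + \<delta>))) m)"
proof -
  let ?s = "1 / (1 + \<delta>)"
  have s: "?s \<noteq> 0" "0 \<le> ?s" "?s \<le> 1" using assms(2) by auto
  have inv: "inv (depol ?s) = depol (1 + \<delta>)" using inv_depol[OF s(1)] by simp
  have lin: "clinear (chan m j)" if "j \<in> map_ix m" for j
    using m that by (simp add: physical_def is_representation_def)
  have "is_representation (transform (depol ?s) m)"
    by (auto simp: is_representation_def transform_def inv intro!: clinear_comp clinear_depol lin)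
  moreover have "psd (depol (1 + \<delta>) (rho m i)) \<and> trace (depol (1 + \<delta>) (rho m i)) = 1"
    if "i \<in> state_ix m" for i
    using m that assms(2) psd_depol_expanding[OF rho[OF that]] by (simp add: physical_def)
  moreover have "completely_positive (depol (1 + \<delta>) \<circ> chan m j \<circ> depol ?s)
      \<and> trace_preserving (depol (1 + \<delta>) \<circ> chan m j \<circ> depol ?s)"
    if "j \<in> map_ix m" for j
  proof -
    have "completely_positive (chan m j)" "trace_preserving (chan m j)"
      using m that by (simp_all add: physical_def)
    with completely_positive_depol_conjugate[OF lin _ _ choi] that assms(2)
    show ?thesis by (simp add: trace_preserving_def)
  qed
  moreover have "psd (depol ?s (eff m k)) \<and> psd (mat 1 - depol ?s (eff m k))"
    if "k \<in> meas_ix m" for k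
  proof -
    \<comment> \<open>Since \<open>depol\<close> fixes the identity, the upper bound on an effect is
      positivity of a transformed complement.\<close>
    have "mat 1 - depol ?s (eff m k) = depol ?s (mat 1 - eff m k)"
      by (simp add: depol_diff)
    then show ?thesis
      using m that s(2,3) by (auto simp: physical_def intro: psd_depol)
  qed
  ultimately show ?thesis
    by (simp add: physical_def transform_def inv dual_map_depol)
qed

lemma trivial_model_if_transform_eq:
  fixes m :: "('i, 'j, 'k, 'n::finite) representation"
  assumes m: "physical m" and S: "S \<in> symmetries" and r: "r > 0" "r \<noteq> 1"
    and eq: "transform (depol r) m = transform S m"
  shows "trivial_model m"
proof -
  have inv: "inv (depol r) = depol (1 / r)" using r by (intro inv_depol) simp
  \<comment> \<open>One argument for all three families: \<open>inv S\<close> keeps the variance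
    while \<open>depol s\<close> multiplies it by \<open>s^2\<close>, which differs from 1, so the
    variance is 0.\<close>
  have maximally_mixed: "X = mat (trace X / of_nat CARD('n))"
    if "psd X" "inv S X = depol s X" "s > 0" "s \<noteq> 1" for s and X :: "'n cmat"
  proof (rule hs_variance_eq_0)
    show "hermitian X" using that(1) by (simp add: psd_def)
    have "hs_variance X = (of_real s)\<^sup>2 * hs_variance X"
      using inv_symmetry(2)[OF S, of X] that(2) by (simp add: hs_variance_depol)
    moreover have "(complex_of_real s)\<^sup>2 \<noteq> 1"
      using that(3,4) by (auto simp: power2_eq_1_iff complex_eq_iff)
    ultimately show "hs_variance X = 0" by simp
  qed
  have r': "1 / r > 0" "1 / r \<noteq> 1" using r by auto
  have "rho m i = mat (1 / of_nat CARD('n))" if "i \<in> state_ix m" for i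
  proof -
    have "rho (transform (depol r) m) i = rho (transform S m) i" by (simp add: eq)
    then have "inv S (rho m i) = depol (1 / r) (rho m i)"
      using that by (simp add: transform_def inv)
    moreover have "psd (rho m i)" "trace (rho m i) = 1"
      using m that by (simp_all add: physical_def)
    ultimately show ?thesis using maximally_mixed[of "rho m i"] r' by simp
  qed
  moreover have "chan m j (mat 1) = mat 1" if "j \<in> map_ix m" for j
  proof -
    \<comment> \<open>Both maps fix the identity, so the image of \<open>mat 1\<close> under the
      channel transforms like a state.\<close>
    have "chan (transform (depol r) m) j (mat 1) = chan (transform S m) j (mat 1)" by (simp add: eq)
    then have "inv S (chan m j (mat 1)) = depol (1 / r) (chan m j (mat 1))"
      using that by (simp add: transform_def inv symmetriesD(4)[OF S])
    moreover have "psd (mat 1 :: 'n cmat)" using psd_mat[of 1] by simp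
    then have "psd (chan m j (mat 1))"
      using m that by (auto simp: physical_def intro: completely_positive_psd)
    moreover have "trace (chan m j (mat 1)) = of_nat CARD('n)"
      using m that by (simp add: physical_def trace_preserving_def trace_mat)
    ultimately show ?thesis using maximally_mixed[of "chan m j (mat 1)"] r' by simp
  qed
  moreover have "eff m k = mat (trace (eff m k) / of_nat CARD('n))" if "k \<in> meas_ix m" for k
  proof -
    have "eff (transform (depol r) m) k = eff (transform S m) k" by (simp add: eq)
    \<comment> \<open>For effects the factor is \<open>r\<close> instead of \<open>1 / r\<close>,
      because \<open>depol r\<close> is its own dual.\<close>
    then have "inv S (eff m k) = depol r (eff m k)"
      using that by (simp add: transform_def dual_map_depol dual_map_symmetry[OF S])
    moreover have "psd (eff m k)" using m that by (simp add: physical_def)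
    ultimately show ?thesis using maximally_mixed[of "eff m k"] r by simp
  qed
  ultimately show ?thesis unfolding trivial_model_def by blast
qed

theorem theorem1:
  fixes m :: "('i, 'j, 'k, 'n::finite) representation"
  assumes "physical m"
    and "finite (state_ix m)" and "finite (map_ix m)"
    and "\<not> trivial_model m"
    and "unique_model m"
  shows "((\<exists>i\<in>state_ix m. rank (rho m i) < CARD('n)) \<or>
          (\<exists>j\<in>map_ix m. rank (choi (chan m j)) < CARD('n \<times> 'n)))
       \<and> (\<Prod>i\<in>state_ix m. det (rho m i)) * (\<Prod>j\<in>map_ix m. det (choi (chan m j))) = 0"
proof -
  \<comment> \<open>Both conjuncts of the goal follow from one vanishing determinant.\<close>
  have "(\<exists>i\<in>state_ix m. det (rho m i) = 0) \<or> (\<exists>j\<in>map_ix m. det (choi (chan m j)) = 0)"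
  proof (rule ccontr)
    assume nz: "\<not> ?thesis"
    obtain \<delta>1 where \<delta>1: "\<delta>1 > 0" "\<And>i. i \<in> state_ix m \<Longrightarrow> psd (rho m i - mat (of_real \<delta>1))"
      using finite_psd_lower_bound[of "state_ix m" "rho m"] assms(1,2) nz
      by (auto simp: physical_def)
    obtain \<delta>2 where \<delta>2: "\<delta>2 > 0" "\<And>j. j \<in> map_ix m \<Longrightarrow> psd (choi (chan m j) - mat (of_real \<delta>2))"
      using finite_psd_lower_bound[of "map_ix m" "\<lambda>j. choi (chan m j)"] assms(1,3) nz
      by (auto simp: physical_def completely_positive_psd_choi)
    define \<delta> where "\<delta> = min \<delta>1 \<delta>2"
    \<comment> \<open>With this \<open>r\<close> the inverse of \<open>depol r\<close> is
      \<open>depol (1 + \<delta>)\<close>, the expansion that the lower bound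
      \<open>\<delta>\<close> tolerates.\<close>
    define r where "r = 1 / (1 + \<delta>)"
    have "\<delta> > 0" using \<delta>1(1) \<delta>2(1) by (simp add: \<delta>_def)
    then have r: "r > 0" "r \<noteq> 1" by (auto simp: r_def)
    have "physical (transform (depol r) m)"
      unfolding r_def using assms(1) \<open>\<delta> > 0\<close>
    proof (rule physical_transform_depol)
      show "psd (rho m i - mat (of_real \<delta>))" if "i \<in> state_ix m" for i
        using psd_diff_mat_mono[OF \<delta>1(2)[OF that]] by (simp add: \<delta>_def)
      show "psd (choi (chan m j) - mat (of_real \<delta>))" if "j \<in> map_ix m" for j
        using psd_diff_mat_mono[OF \<delta>2(2)[OF that]] by (simp add: \<delta>_def)
    qed
    moreover have "bij (depol r :: 'n cmat \<Rightarrow> 'n cmat)"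
      using r by (intro o_bij[of "depol (1 / r)"]) (simp_all add: fun_eq_iff depol_depol)
    ultimately have "transform (depol r) m \<in> equiv_physical m"
      using dist_equiv_transform[OF clinear_depol] by (auto simp: equiv_physical_def)
    then have "transform (depol r) m \<in> model m" using assms(5) by (simp add: unique_model_def)
    then obtain S where "S \<in> symmetries" "transform (depol r) m = transform S m"
      by (auto simp: model_def)
    then show False using trivial_model_if_transform_eq assms(1,4) r by blast
  qed
  then show ?thesis
  proof (elim disjE bexE)
    fix i assume i: "i \<in> state_ix m" "det (rho m i) = 0"
    then have "(\<Prod>i\<in>state_ix m. det (rho m i)) = 0" using assms(2) by (intro prod_zero) auto
    then show ?thesis using i(1) det_eq_0_imp_rank_less[OF i(2)] by (simp only: mult_zero_left) blast
  next
    fix j assume j: "j \<in> map_ix m" "det (choi (chan m j)) = 0"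
    then have "(\<Prod>j\<in>map_ix m. det (choi (chan m j))) = 0" using assms(3) by (intro prod_zero) auto
    then show ?thesis using j(1) det_eq_0_imp_rank_less[OF j(2)] by (simp only: mult_zero_right) blast
  qed
qed

end
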